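(* Let $N\ge 2$ be an integer, $0<\beta\le 1$, and let $\eta, P_s, P_r, d_{sr}, d_{rd}, \sigma_r^2, \sigma_d^2$ be positive reals. Let $R_b\ge 0$ and $\tau_b=2^{R_b}-1$. In the relay channel model described in the context, the transmission outage probability $P_{to}=\Pr(\Gamma_D\le\tau_b)$ is $$P_{to}=1-\exp\left(-\left(\frac{1}{\beta\overline{\gamma}_{sr}}+\frac{1}{\overline{\gamma}_{rd}}\right)\tau_b\right)\sum_{n=0}^{N-1}\frac{1}{n!}\left(\frac{\tau_b}{\beta\overline{\gamma}_{sr}}\right)^n,$$ where $\overline{\gamma}_{sr}=P_sd_{sr}^{-\eta}\sigma_r^{-2}$ and $\overline{\gamma}_{rd}=P_rd_{rd}^{-\eta}\sigma_d^{-2}$ (with the convention $0^0=1$).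
   Context: A source with $N$ antennas communicates with a single-antenna destination via a single-antenna decode-and-forward relay; there is no direct source–destination link. $P_s,P_r$ are the transmit powers at the source and relay, $d_{sr},d_{rd}$ the source–relay and relay–destination distances, $\eta$ the path loss exponent, $\sigma_r^2,\sigma_d^2$ the noise variances at the relay and destination, and $\beta$ the fraction of source power allocated to the information signal (the rest is artificial noise sent in the null space of the source–relay channel, so it does not affect the relay). The source–relay channel $\mathbf{h}_{sr}$ (a $1\times N$ vector) and the relay–destination channel coefficient $h_{rd}$ (a scalar) undergo Rayleigh fading: all entries of $\mathbf{h}_{sr}$ and $h_{rd}$ are i.i.d. $\mathcal{CN}(0,1)$ (circularly symmetric complex Gaussian, so squared modulus is exponential with mean $1$). The instantaneous SNR at the destination is $$\Gamma_D=\min\{\gamma_{sr},\gamma_{rd}\},\qquad \gamma_{sr}=\frac{\beta P_s}{d_{sr}^{\eta}\sigma_r^{2}}\|\mathbf{h}_{sr}\|^2,\qquad \gamma_{rd}=\frac{P_r}{d_{rd}^{\eta}\sigma_d^{2}}|h_{rd}|^2,$$ where $\|\cdot\|$ is the Euclidean norm. *)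

theory Defs
  imports "HOL-Probability.Probability"
begin

text \<open>
  Circularly symmetric complex Gaussian CN(0,v): the real and imaginary parts are independent
  real normal variables of mean 0 and variance v/2 each. Note that \<^const>\<open>normal_density\<close>
  is parametrised by the standard deviation, not the variance.
\<close>

definition complex_gaussian :: "'a measure \<Rightarrow> ('a \<Rightarrow> complex) \<Rightarrow> real \<Rightarrow> bool" where
  "complex_gaussian M Z v \<longleftrightarrow>
     prob_space.indep_var M borel (\<lambda>\<omega>. Re (Z \<omega>)) borel (\<lambda>\<omega>. Im (Z \<omega>)) \<and>
     distributed M lborel (\<lambda>\<omega>. Re (Z \<omega>)) (normal_density 0 (sqrt (v / 2))) \<and>
     distributed M lborel (\<lambda>\<omega>. Im (Z \<omega>)) (normal_density 0 (sqrt (v / 2)))"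

text \<open>
  Joint independence of all entries of the source-relay vector together with the relay-destination
  coefficient is expressed by one family over the index type \<^typ>\<open>'n option\<close>, where
  \<^const>\<open>None\<close> stands for the relay-destination coefficient.
\<close>

definition rayleigh_fading ::
  "'a measure \<Rightarrow> ('a \<Rightarrow> complex ^ 'n) \<Rightarrow> ('a \<Rightarrow> complex) \<Rightarrow> bool" where
  "rayleigh_fading M h_sr h_rd \<longleftrightarrow>
     prob_space.indep_vars M (\<lambda>_. borel)
       (\<lambda>k \<omega>. case k of None \<Rightarrow> h_rd \<omega> | Some i \<Rightarrow> h_sr \<omega> $ i) (UNIV :: 'n option set) \<and>
     (\<forall>i. complex_gaussian M (\<lambda>\<omega>. h_sr \<omega> $ i) 1) \<and>
     complex_gaussian M h_rd 1"

text \<open>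
  In the following definitions the noise arguments v, v_r and v_d are variances. The norm on \<^typ>\<open>complex ^ 'n\<close> is the Euclidean one.
\<close>

definition snr_sr ::
  "real \<Rightarrow> real \<Rightarrow> real \<Rightarrow> real \<Rightarrow> real \<Rightarrow> complex ^ 'n \<Rightarrow> real" where
  "snr_sr \<beta> P_s d_sr \<eta> v_r h = \<beta> * P_s / (d_sr powr \<eta> * v_r) * (norm h)\<^sup>2"

definition snr_rd :: "real \<Rightarrow> real \<Rightarrow> real \<Rightarrow> real \<Rightarrow> complex \<Rightarrow> real" where
  "snr_rd P_r d_rd \<eta> v_d h = P_r / (d_rd powr \<eta> * v_d) * (cmod h)\<^sup>2"

definition snr_destination ::
  "real \<Rightarrow> real \<Rightarrow> real \<Rightarrow> real \<Rightarrow> real \<Rightarrow> real \<Rightarrow> real \<Rightarrow> real \<Rightarrow>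
    complex ^ 'n \<Rightarrow> complex \<Rightarrow> real" where
  "snr_destination \<beta> \<eta> P_s P_r d_sr d_rd v_r v_d h_sr h_rd =
     min (snr_sr \<beta> P_s d_sr \<eta> v_r h_sr) (snr_rd P_r d_rd \<eta> v_d h_rd)"

definition mean_snr :: "real \<Rightarrow> real \<Rightarrow> real \<Rightarrow> real \<Rightarrow> real" where
  "mean_snr P d \<eta> v = P * d powr (- \<eta>) * inverse v"

definition outage_probability :: "'a measure \<Rightarrow> ('a \<Rightarrow> real) \<Rightarrow> real \<Rightarrow> real" where
  "outage_probability M \<Gamma> \<tau> = measure M {\<omega> \<in> space M. \<Gamma> \<omega> \<le> \<tau>}"

end

theory Submission
  imports Defs
begin

text \<open>
  In polar coordinates, the squared modulus of a standard complex Gaussian is exponential with mean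
  1, so the squared norm of the source-relay vector is Erlang distributed of shape N. The destination
  SNR exceeds the threshold iff both link SNRs do, and these are independent.
\<close>

text \<open>The reflection x -> -x carries one closed half-line to the other.\<close>

lemma nn_integral_even_function:
  fixes f :: "real \<Rightarrow> ennreal"
  assumes [measurable]: "f \<in> borel_measurable borel"
    and even: "\<And>x. f (- x) = f x"
  shows "(\<integral>\<^sup>+x. f x \<partial>lborel) = 2 * (\<integral>\<^sup>+x. f x * indicator {0..} x \<partial>lborel)"
proof -
  have "(\<integral>\<^sup>+x. f x * indicator {..0} x \<partial>lborel) = (\<integral>\<^sup>+x. f x * indicator {0..} x \<partial>lborel)"
    by (subst nn_integral_real_affine[where c = "-1" and t = 0])
       (auto simp: even intro!: nn_integral_cong split: split_indicator)
  moreover have "(\<integral>\<^sup>+x. f x \<partial>lborel) =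
      (\<integral>\<^sup>+x. f x * indicator {0..} x + f x * indicator {..0} x \<partial>lborel)"
    \<comment> \<open>The two closed half-lines overlap at 0, where \<open>f\<close> is counted
      twice; this is a null set.\<close>
    by (intro nn_integral_cong_AE AE_I[where N = "{0}"]) (auto split: split_indicator)
  ultimately show ?thesis
    by (simp add: nn_integral_add mult_2)
qed

text \<open>The antiderivative is arctan. In the radial formula below, s = y / x is the slope of a
  line through the origin, and this integral is the total angle swept by such lines.\<close>

lemma nn_integral_Cauchy_density:
  "(\<integral>\<^sup>+s. ennreal (1 / (1 + s\<^sup>2)) \<partial>lborel) = ennreal pi"
proof -
  have "(\<integral>\<^sup>+s. ennreal (1 / (1 + s\<^sup>2)) * indicator {0..} s \<partial>lborel) = ennreal (pi / 2 - arctan 0)"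
    by (rule nn_integral_FTC_atLeast)
       (auto intro!: derivative_eq_intros tendsto_arctan_at_top simp: add_nonneg_eq_0_iff field_simps power2_eq_square)
  then have "(\<integral>\<^sup>+s. ennreal (1 / (1 + s\<^sup>2)) \<partial>lborel) = 2 * ennreal (pi / 2)"
    by (subst nn_integral_even_function) auto
  also have "\<dots> = ennreal (2 * (pi / 2))"
    by (subst ennreal_mult) auto
  finally show ?thesis by simp
qed

text \<open>Polar coordinates obtained from one-dimensional substitutions only: put y = x * s,
  exchange the integrals, then rescale x by sqrt (1 + s^2). Each line through the origin is
  parametrised by a signed distance t over all reals, hence \<bar>t\<bar> and the angular factor pi
  instead of 2 * pi.\<close>

lemma nn_integral_radial_plane:
  fixes g :: "real \<Rightarrow> ennreal"
  assumes [measurable]: "g \<in> borel_measurable borel"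
  shows "(\<integral>\<^sup>+x. \<integral>\<^sup>+y. g (x\<^sup>2 + y\<^sup>2) \<partial>lborel \<partial>lborel) =
    ennreal pi * (\<integral>\<^sup>+t. ennreal \<bar>t\<bar> * g (t\<^sup>2) \<partial>lborel)"
proof -
  have "(\<integral>\<^sup>+x. \<integral>\<^sup>+y. g (x\<^sup>2 + y\<^sup>2) \<partial>lborel \<partial>lborel) =
      (\<integral>\<^sup>+x. \<integral>\<^sup>+s. ennreal \<bar>x\<bar> * g (x\<^sup>2 * (1 + s\<^sup>2)) \<partial>lborel \<partial>lborel)"
  \<comment> \<open>The substitution y = x * s degenerates at x = 0, a null set.\<close>
  proof (intro nn_integral_cong_AE AE_I[where N = "{0}"])
    have "(\<integral>\<^sup>+y. g (x\<^sup>2 + y\<^sup>2) \<partial>lborel) = (\<integral>\<^sup>+s. ennreal \<bar>x\<bar> * g (x\<^sup>2 * (1 + s\<^sup>2)) \<partial>lborel)"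
      if "x \<noteq> 0" for x
      using that by (subst nn_integral_real_affine[where c = x and t = 0])
        (auto simp: nn_integral_cmult[symmetric] power_mult_distrib distrib_left)
    then show "{x \<in> space lborel. \<not> (\<integral>\<^sup>+y. g (x\<^sup>2 + y\<^sup>2) \<partial>lborel) =
        (\<integral>\<^sup>+s. ennreal \<bar>x\<bar> * g (x\<^sup>2 * (1 + s\<^sup>2)) \<partial>lborel)} \<subseteq> {0}"
      by blast
  qed auto
  also have "\<dots> = (\<integral>\<^sup>+s. \<integral>\<^sup>+x. ennreal \<bar>x\<bar> * g (x\<^sup>2 * (1 + s\<^sup>2)) \<partial>lborel \<partial>lborel)"
    by (rule lborel_pair.Fubini'[symmetric]) auto
  also have "\<dots> = (\<integral>\<^sup>+s. ennreal (1 / (1 + s\<^sup>2)) * (\<integral>\<^sup>+t. ennreal \<bar>t\<bar> * g (t\<^sup>2) \<partial>lborel) \<partial>lborel)"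
  proof (rule nn_integral_cong)
    fix s :: real
    \<comment> \<open>The point (x, x * s) has signed distance t = r * x from the origin. One factor
      r comes from dt = r dx and one from \<bar>t\<bar> = r * \<bar>x\<bar>; together they produce
      the weight 1 / (1 + s^2).\<close>
    define r where "r = sqrt (1 + s\<^sup>2)"
    have r: "r > 0" "r\<^sup>2 = 1 + s\<^sup>2"
      by (auto simp: r_def add_pos_nonneg)
    have "ennreal r * (ennreal \<bar>x\<bar> * g (x\<^sup>2 * r\<^sup>2)) = ennreal \<bar>r * x\<bar> * g ((r * x)\<^sup>2)" for x
      using r by (simp add: abs_mult ennreal_mult power_mult_distrib mult.assoc mult.commute[of "x\<^sup>2"])
    then have "(\<integral>\<^sup>+t. ennreal \<bar>t\<bar> * g (t\<^sup>2) \<partial>lborel) =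
        ennreal r * (\<integral>\<^sup>+x. ennreal r * (ennreal \<bar>x\<bar> * g (x\<^sup>2 * r\<^sup>2)) \<partial>lborel)"
      using r(1) by (subst nn_integral_real_affine[where c = r and t = 0]) simp_all
    also have "\<dots> = ennreal (r\<^sup>2) * (\<integral>\<^sup>+x. ennreal \<bar>x\<bar> * g (x\<^sup>2 * r\<^sup>2) \<partial>lborel)"
      using r(1) by (simp add: nn_integral_cmult power2_eq_square ennreal_mult mult.assoc)
    finally have "ennreal (1 / r\<^sup>2) * (\<integral>\<^sup>+t. ennreal \<bar>t\<bar> * g (t\<^sup>2) \<partial>lborel) =
        ennreal (1 / r\<^sup>2 * r\<^sup>2) * (\<integral>\<^sup>+x. ennreal \<bar>x\<bar> * g (x\<^sup>2 * r\<^sup>2) \<partial>lborel)"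
      by (subst ennreal_mult) (auto simp: mult.assoc)
    then show "(\<integral>\<^sup>+x. ennreal \<bar>x\<bar> * g (x\<^sup>2 * (1 + s\<^sup>2)) \<partial>lborel) =
        ennreal (1 / (1 + s\<^sup>2)) * (\<integral>\<^sup>+t. ennreal \<bar>t\<bar> * g (t\<^sup>2) \<partial>lborel)"
      using r(1) by (simp add: r(2)[symmetric])
  qed
  also have "\<dots> = ennreal pi * (\<integral>\<^sup>+t. ennreal \<bar>t\<bar> * g (t\<^sup>2) \<partial>lborel)"
    by (subst nn_integral_multc) (simp_all only: nn_integral_Cauchy_density, measurable)
  finally show ?thesis .
qed

text \<open>On the positive half-line the antiderivative is - exp (- t^2) / 2; its factor 1/2
  cancels the 2 coming from evenness.\<close>

lemma nn_integral_abs_gaussian_tail: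
  assumes "0 \<le> a"
  shows "(\<integral>\<^sup>+t. ennreal \<bar>t\<bar> * (ennreal (exp (- t\<^sup>2)) * indicator {a<..} (t\<^sup>2)) \<partial>lborel) = ennreal (exp (- a))"
    (is "?I = _")
proof -
  let ?f = "\<lambda>t::real. ennreal \<bar>t\<bar> * (ennreal (exp (- t\<^sup>2)) * indicator {a<..} (t\<^sup>2))"
  \<comment> \<open>The strict condition a < t^2 becomes the closed half-line that the fundamental
    theorem expects; the endpoint sqrt a is excluded here and discarded later as a null set.\<close>
  have tail: "?f t * indicator {0..} t = ennreal (t * exp (- t\<^sup>2)) * indicator {sqrt a..} t"
    if "t \<noteq> sqrt a" for t
  proof (cases "0 \<le> t")
    case True
    then have "a < t\<^sup>2 \<longleftrightarrow> sqrt a \<le> t"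
      using that assms by (metis less_eq_real_def not_le real_less_lsqrt real_less_rsqrt power2_eq_square real_sqrt_abs abs_of_nonneg)
    then show ?thesis
      using True by (auto simp: ennreal_mult split: split_indicator)
  next
    case False
    then have "\<not> sqrt a \<le> t"
      using assms by (meson dual_order.trans real_sqrt_ge_zero)
    then show ?thesis
      using False by simp
  qed
  have "?I = 2 * (\<integral>\<^sup>+t. ?f t * indicator {0..} t \<partial>lborel)"
    by (subst nn_integral_even_function) auto
  also have "(\<integral>\<^sup>+t. ?f t * indicator {0..} t \<partial>lborel) =
      (\<integral>\<^sup>+t. ennreal (t * exp (- t\<^sup>2)) * indicator {sqrt a..} t \<partial>lborel)"
    by (intro nn_integral_cong_AE AE_I[where N = "{sqrt a}"]) (use tail in auto)
  also have "\<dots> = ennreal (0 - (- exp (- (sqrt a)\<^sup>2) / 2))"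
  proof (rule nn_integral_FTC_atLeast)
    show "((\<lambda>t. - exp (- t\<^sup>2) / 2) \<longlongrightarrow> (0 :: real)) at_top"
      by real_asymp
    show "0 \<le> t * exp (- t\<^sup>2)" if "sqrt a \<le> t" for t :: real
      using that assms by (meson dual_order.trans real_sqrt_ge_zero exp_ge_zero mult_nonneg_nonneg)
  qed (auto intro!: derivative_eq_intros)
  finally show ?thesis
    using assms by (simp add: ennreal_mult[symmetric] flip: ennreal_numeral)
qed

lemma (in prob_space) complex_gaussian_borel_measurable:
  assumes "complex_gaussian M Z v"
  shows "random_variable borel Z"
proof -
  have "random_variable borel (\<lambda>\<omega>. Re (Z \<omega>))" "random_variable borel (\<lambda>\<omega>. Im (Z \<omega>))"
    using assms by (auto simp: complex_gaussian_def distributed_def)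
  then show ?thesis
    by (simp add: borel_measurable_complex_iff)
qed

text \<open>Independence makes the joint density of real and imaginary part radial, so the tail
  probability is a radial plane integral; its angular factor pi cancels the normalisation 1 /
  pi.\<close>

lemma (in prob_space) complex_gaussian_cmod_square_exponential:
  assumes Z: "complex_gaussian M Z 1"
  shows "distributed M lborel (\<lambda>\<omega>. (cmod (Z \<omega>))\<^sup>2) (exponential_density 1)"
proof (subst exponential_distributed_iff, simp, intro conjI allI impI)
  note [measurable] = complex_gaussian_borel_measurable[OF Z]
  show "random_variable borel (\<lambda>\<omega>. (cmod (Z \<omega>))\<^sup>2)"
    by simp
  let ?n = "normal_density 0 (sqrt (1 / 2))"
  fix a :: real assume a: "0 \<le> a"
  \<comment> \<open>Each part has variance 1/2, so twice the variance is 1 and the two factors 1 /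
    sqrt pi multiply to 1 / pi.\<close>
  have dens: "?n x * ?n y = exp (- (x\<^sup>2 + y\<^sup>2)) / pi" for x y
    by (simp add: normal_density_def exp_add exp_minus field_simps flip: exp_add)
  have "distributed M (lborel \<Otimes>\<^sub>M lborel) (\<lambda>\<omega>. (Re (Z \<omega>), Im (Z \<omega>)))
      (\<lambda>(x, y). ennreal (?n x) * ennreal (?n y))"
    using Z by (intro distributed_joint_indep)
      (auto simp: complex_gaussian_def indep_var_eq lborel.sigma_finite_measure_axioms)
  \<comment> \<open>The joint density is integrated over the exterior of the disc of radius sqrt
    a.\<close>
  then have "(\<integral>\<^sup>+p. (case p of (x, y) \<Rightarrow> ennreal (?n x) * ennreal (?n y)) * indicator {a<..} ((fst p)\<^sup>2 + (snd p)\<^sup>2) \<partial>(lborel \<Otimes>\<^sub>M lborel)) =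
      (\<integral>\<^sup>+\<omega>. indicator {a<..} ((Re (Z \<omega>))\<^sup>2 + (Im (Z \<omega>))\<^sup>2) \<partial>M)"
    by (subst distributed_nn_integral) auto
  also have "\<dots> = (\<integral>\<^sup>+\<omega>. indicator {\<omega> \<in> space M. a < (cmod (Z \<omega>))\<^sup>2} \<omega> \<partial>M)"
    by (intro nn_integral_cong) (auto simp: cmod_power2 split: split_indicator)
  also have "\<dots> = emeasure M {\<omega> \<in> space M. a < (cmod (Z \<omega>))\<^sup>2}"
    by simp
  finally have "emeasure M {\<omega> \<in> space M. a < (cmod (Z \<omega>))\<^sup>2} =
      (\<integral>\<^sup>+x. \<integral>\<^sup>+y. ennreal (?n x) * ennreal (?n y) * indicator {a<..} (x\<^sup>2 + y\<^sup>2) \<partial>lborel \<partial>lborel)"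
    by (subst (asm) lborel.nn_integral_fst[symmetric]) auto
  also have "\<dots> = (\<integral>\<^sup>+x. \<integral>\<^sup>+y. ennreal (exp (- (x\<^sup>2 + y\<^sup>2)) / pi) * indicator {a<..} (x\<^sup>2 + y\<^sup>2) \<partial>lborel \<partial>lborel)"
    by (simp only: dens flip: ennreal_mult[OF normal_density_nonneg normal_density_nonneg])
  also have "\<dots> = ennreal pi * (\<integral>\<^sup>+t. ennreal \<bar>t\<bar> * (ennreal (exp (- t\<^sup>2) / pi) * indicator {a<..} (t\<^sup>2)) \<partial>lborel)"
    by (rule nn_integral_radial_plane) measurable
  also have "\<dots> = (\<integral>\<^sup>+t. ennreal \<bar>t\<bar> * (ennreal (exp (- t\<^sup>2)) * indicator {a<..} (t\<^sup>2)) \<partial>lborel)"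
    by (subst nn_integral_cmult[symmetric])
       (auto intro!: nn_integral_cong simp: ennreal_mult[symmetric] split: split_indicator)
  also have "\<dots> = ennreal (exp (- a))"
    by (rule nn_integral_abs_gaussian_tail[OF a])
  finally have "prob {\<omega> \<in> space M. a < (cmod (Z \<omega>))\<^sup>2} = exp (- a)"
    by (simp add: emeasure_eq_measure)
  moreover have "{\<omega> \<in> space M. (cmod (Z \<omega>))\<^sup>2 \<le> a} = space M - {\<omega> \<in> space M. a < (cmod (Z \<omega>))\<^sup>2}"
    by auto
  ultimately show "\<P>(\<omega> in M. (cmod (Z \<omega>))\<^sup>2 \<le> a) = 1 - exp (- a * 1)"
    by (simp add: prob_compl)
qed

lemma norm_square_vec: "(norm x)\<^sup>2 = (\<Sum>i\<in>UNIV. (norm (x $ i))\<^sup>2)"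
  by (simp add: norm_vec_def L2_set_def sum_nonneg)

text \<open>The squared moduli are independent standard exponentials. Those indexed by
  \<open>Some\<close> sum to the squared norm, which is Erlang; the one at \<open>None\<close> is
  independent of that sum, so the two tails multiply.\<close>

lemma (in prob_space) rayleigh_fading_joint_tail:
  fixes h_sr :: "'a \<Rightarrow> complex ^ 'n"
  assumes "rayleigh_fading M h_sr h_rd" and "0 \<le> a" and "0 \<le> b"
  shows "\<P>(\<omega> in M. a < (norm (h_sr \<omega>))\<^sup>2 \<and> b < (cmod (h_rd \<omega>))\<^sup>2) =
    exp (- (a + b)) * (\<Sum>n = 0..CARD('n) - 1. a ^ n / fact n)"
proof -
  let ?Z = "\<lambda>k \<omega>. case k of None \<Rightarrow> h_rd \<omega> | Some i \<Rightarrow> h_sr \<omega> $ i"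
  let ?X = "\<lambda>k \<omega>. (cmod (?Z k \<omega>))\<^sup>2"
  let ?S = "\<lambda>\<omega>. \<Sum>k\<in>range Some. ?X k \<omega>"
  have indep: "indep_vars (\<lambda>_. borel) ?X (UNIV :: 'n option set)"
    by (rule indep_vars_compose2[where M' = "\<lambda>_. borel" and X = ?Z and Y = "\<lambda>_ z. (cmod z)\<^sup>2"])
       (use assms in \<open>auto simp: rayleigh_fading_def\<close>)
  have gauss: "complex_gaussian M (?Z k) 1" for k :: "'n option"
    using assms by (cases k) (auto simp: rayleigh_fading_def)
  have X: "distributed M lborel (?X k) (exponential_density 1)" for k :: "'n option"
    by (rule complex_gaussian_cmod_square_exponential[OF gauss])
  \<comment> \<open>The index of \<open>erlang_density\<close> is the shape minus one, which is why
    the final sum stops at N - 1.\<close>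
  have "distributed M lborel ?S (erlang_density (card (range (Some :: 'n \<Rightarrow> _)) - 1) 1)"
    by (rule exponential_distributed_sum) (auto intro: X indep_vars_subset[OF indep])
  then have S: "distributed M lborel ?S (erlang_density (CARD('n) - 1) 1)"
    by (simp add: card_image)
  have norm: "(norm (h_sr \<omega>))\<^sup>2 = ?S \<omega>" for \<omega>
    by (simp add: norm_square_vec sum.reindex)
  \<comment> \<open>Joint independence of the whole family applies because \<open>None\<close> lies
    outside \<open>range Some\<close>.\<close>
  have "indep_var borel (?X None) borel ?S"
    by (rule indep_vars_sum) (auto intro: indep_vars_subset[OF indep])
  then have "\<P>(\<omega> in M. ?X None \<omega> \<in> {b<..} \<and> ?S \<omega> \<in> {a<..}) =
      \<P>(\<omega> in M. ?X None \<omega> \<in> {b<..}) * \<P>(\<omega> in M. ?S \<omega> \<in> {a<..})"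
    by (rule prob_indep_random_variable) auto
  also have "\<dots> = exp (- b) * (1 - erlang_CDF (CARD('n) - 1) 1 a)"
    using exponential_distributedD_gt[OF X assms(3), of None]
      erlang_distributed_gt[OF S _ assms(2)] by simp
  also have "1 - erlang_CDF (CARD('n) - 1) 1 a = exp (- a) * (\<Sum>n = 0..CARD('n) - 1. a ^ n / fact n)"
    using assms(2) by (simp add: erlang_CDF_def sum_distrib_left atLeast0AtMost mult.commute)
  finally show ?thesis
    by (simp add: norm conj_commute exp_add mult.assoc mult.left_commute exp_diff exp_minus field_simps)
qed

theorem mainTheorem2:
  fixes M :: "'a measure"
    and h_sr :: "'a \<Rightarrow> complex ^ 'n" and h_rd :: "'a \<Rightarrow> complex"
    and N :: nat
    and \<beta> \<eta> P_s P_r d_sr d_rd v_r v_d R_b \<tau>_b :: real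
  assumes "prob_space M"
    and "rayleigh_fading M h_sr h_rd"
    and "N = CARD('n)" and "N \<ge> 2"
    and "0 < \<beta>" and "\<beta> \<le> 1"
    and "\<eta> > 0" and "P_s > 0" and "P_r > 0" and "d_sr > 0" and "d_rd > 0"
    and "v_r > 0" and "v_d > 0"
    and "R_b \<ge> 0" and "\<tau>_b = 2 powr R_b - 1"
  shows "outage_probability M
      (\<lambda>\<omega>. snr_destination \<beta> \<eta> P_s P_r d_sr d_rd v_r v_d (h_sr \<omega>) (h_rd \<omega>)) \<tau>_b =
    1 - exp (- (1 / (\<beta> * mean_snr P_s d_sr \<eta> v_r) + 1 / mean_snr P_r d_rd \<eta> v_d) * \<tau>_b) *
      (\<Sum>n=0..N-1. 1 / fact n * (\<tau>_b / (\<beta> * mean_snr P_s d_sr \<eta> v_r)) ^ n)"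
proof -
  interpret prob_space M by fact
  \<comment> \<open>\<open>A\<close> and \<open>B\<close> are the factors multiplying the squared
    channel norms in the two link SNRs, so the threshold on each squared norm is \<tau>_b divided by
    \<open>A\<close> or \<open>B\<close>.\<close>
  define A where "A = \<beta> * mean_snr P_s d_sr \<eta> v_r"
  define B where "B = mean_snr P_r d_rd \<eta> v_d"
  have pos: "A > 0" "B > 0"
    using assms by (auto simp: A_def B_def mean_snr_def)
  have "1 \<le> 2 powr R_b"
    using assms by (simp add: ge_one_powr_ge_zero)
  then have \<tau>: "0 \<le> \<tau>_b"
    using assms by simp
  have sr: "snr_sr \<beta> P_s d_sr \<eta> v_r h = A * (norm h)\<^sup>2" for h :: "complex ^ 'n"
    by (simp add: snr_sr_def A_def mean_snr_def powr_minus field_simps)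
  have rd: "snr_rd P_r d_rd \<eta> v_d h = B * (cmod h)\<^sup>2" for h
    by (simp add: snr_rd_def B_def mean_snr_def powr_minus field_simps)
  let ?E = "{\<omega> \<in> space M. \<tau>_b / A < (norm (h_sr \<omega>))\<^sup>2 \<and> \<tau>_b / B < (cmod (h_rd \<omega>))\<^sup>2}"
  have "random_variable borel (\<lambda>\<omega>. h_sr \<omega> $ i)" "random_variable borel h_rd" for i
    using assms(2) complex_gaussian_borel_measurable by (auto simp: rayleigh_fading_def)
  note [measurable] = this
  \<comment> \<open>The fading hypothesis speaks of the entries only, so measurability of the norm
    is reduced to them.\<close>
  have [measurable]: "random_variable borel (\<lambda>\<omega>. (norm (h_sr \<omega>))\<^sup>2)"
    unfolding norm_square_vec by measurable
  \<comment> \<open>A minimum is at most \<tau>_b iff one of its arguments is; so outage is the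
    complement of both links exceeding it.\<close>
  have "{\<omega> \<in> space M. snr_destination \<beta> \<eta> P_s P_r d_sr d_rd v_r v_d (h_sr \<omega>) (h_rd \<omega>) \<le> \<tau>_b} =
      space M - ?E"
    using pos by (auto simp: snr_destination_def sr rd min_le_iff_disj field_simps not_less)
  then have "outage_probability M
      (\<lambda>\<omega>. snr_destination \<beta> \<eta> P_s P_r d_sr d_rd v_r v_d (h_sr \<omega>) (h_rd \<omega>)) \<tau>_b = 1 - prob ?E"
    by (simp add: outage_probability_def prob_compl)
  \<comment> \<open>At \<tau>_b = 0 only the term n = 0 survives, with 0 ^ 0 = 1, and
    \<open>?E\<close> has probability 1.\<close>
  also have "prob ?E = exp (- (\<tau>_b / A + \<tau>_b / B)) * (\<Sum>n=0..N-1. 1 / fact n * (\<tau>_b / A) ^ n)"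
    using rayleigh_fading_joint_tail[OF assms(2), of "\<tau>_b / A" "\<tau>_b / B"] \<tau> pos assms(3) by simp
  also have "- (\<tau>_b / A + \<tau>_b / B) = - (1 / A + 1 / B) * \<tau>_b"
    by (simp add: algebra_simps)
  finally show ?thesis
    unfolding A_def B_def .
qed

end
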